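(* Let $g \in L^2(\mathbb{R}^d,\mathbb{R})$ be a real-valued window function and let $\mathcal{L} = \mathcal{A}\times\mathcal{B} \subseteq \mathbb{R}^{2d}$ be a separable lattice, where $\mathcal{A},\mathcal{B}$ are lattices in $\mathbb{R}^d$. Then there exist $f_1,f_2 \in L^2(\mathbb{R}^d)$ which satisfy all of the following: (1) $|V_g f_1(z)|=|V_g f_2(z)|$ for all $z \in \mathcal{L}$; (2) $|f_1(t)| = |f_2(t)|$ for all $t \in \mathbb{R}^d$; (3) there is no $\nu\in\mathbb{C}$ with $|\nu|=1$ and $f_1=\nu f_2$.
   Context: $V_gf(x,\omega)=\int_{\mathbb{R}^d} f(t)\overline{g(t-x)}e^{-2\pi i \omega\cdot t}\,dt$ is the short-time Fourier transform. A lattice in $\mathbb{R}^d$ is $A\mathbb{Z}^d$ with $A\in\mathrm{GL}_d(\mathbb{R})$. $L^2(\mathbb{R}^d,\mathbb{R})$ denotes the real-valued functions in $L^2(\mathbb{R}^d)$. *)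

theory Defs
  imports "HOL-Analysis.Analysis"
begin

definition L2 :: "(real^'n \<Rightarrow> complex) \<Rightarrow> bool" where
  "L2 f \<longleftrightarrow> f \<in> borel_measurable lebesgue \<and>
            integrable lebesgue (\<lambda>t. (cmod (f t))\<^sup>2)"

definition L2_real :: "(real^'n \<Rightarrow> real) \<Rightarrow> bool" where
  "L2_real g \<longleftrightarrow> g \<in> borel_measurable lebesgue \<and>
            integrable lebesgue (\<lambda>t. (g t)\<^sup>2)"

definition STFT :: "(real^'n \<Rightarrow> complex) \<Rightarrow> (real^'n \<Rightarrow> complex)
                    \<Rightarrow> real^'n \<Rightarrow> real^'n \<Rightarrow> complex" where
  "STFT g f x \<omega> = integral\<^sup>L lebesgue
     (\<lambda>t. f t * cnj (g (t - x)) * exp (- 2 * of_real pi * \<i> * of_real (\<omega> \<bullet> t)))"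

definition lattice_of :: "real^'n^'n \<Rightarrow> (real^'n) set" where
  "lattice_of A = {A *v k | k. \<forall>i. k $ i \<in> \<int>}"

end

theory Submission
  imports Defs
begin

text \<open>
  Write \<open>g\<^sup>-(t) = g(-t)\<close> and choose \<open>\<lambda> \<noteq> 0\<close> in the lattice dual to \<open>\<B>\<close>, so that \<open>\<omega> \<bullet> \<lambda> \<in> \<int>\<close> for
  \<open>\<omega> \<in> \<B>\<close>. For \<open>\<mu> \<in> {0, \<lambda>}\<close> the substitution \<open>t \<mapsto> x + \<mu> - t\<close> exchanges the two factors of
  \<open>g(\<mu> - t) g(t - x)\<close>, so the value \<open>S\<close> of the transform of \<open>g\<^sup>-(\<cdot> - \<mu>)\<close> at \<open>(x, \<omega>)\<close> satisfies
  \<open>S = e\<^bsup>-2\<pi>i \<omega>\<bullet>x\<^esup> cnj S\<close>, with a phase that does not depend on \<open>\<mu>\<close>. Hence the functions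
  \<open>g\<^sup>- \<plusminus> i g\<^sup>-(\<cdot> - \<lambda>)\<close>, which are complex conjugates of each other, have transforms of
  equal modulus. If they agreed up to a phase, \<open>(g\<^sup>-)\<^sup>2\<close> would be \<open>\<lambda>\<close>-periodic and integrable,
  hence zero. A window that vanishes almost everywhere has zero transform, and then any nonzero
  real function can take the place of \<open>g\<^sup>-\<close>.
\<close>

section \<open>Reflections and translations of Lebesgue measure\<close>

lemma
  fixes a :: "'a::euclidean_space"
  shows measurable_lebesgue_reflect: "(\<lambda>t. a - t) \<in> lebesgue \<rightarrow>\<^sub>M lebesgue"
    and distr_lebesgue_reflect: "distr lebesgue lebesgue (\<lambda>t. a - t) = lebesgue"
proof -
  \<comment> \<open>The library treats affine maps that scale each coordinate; here every factor is
    \<open>-1\<close>, so the Jacobian has modulus 1.\<close>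
  have eq: "(\<lambda>t. a + (\<Sum>j\<in>Basis. (- 1 * (t \<bullet> j)) *\<^sub>R j)) = (\<lambda>t. a - t)"
    by (simp add: fun_eq_iff sum_negf euclidean_representation)
  show "(\<lambda>t. a - t) \<in> lebesgue \<rightarrow>\<^sub>M lebesgue"
    using lebesgue_affine_measurable[of "\<lambda>_. -1" a] unfolding eq by simp
  show "distr lebesgue lebesgue (\<lambda>t. a - t) = lebesgue"
    using lebesgue_affine_euclidean[of "\<lambda>_. -1" a] unfolding eq by (simp add: density_1)
qed

lemma measurable_lebesgue_reflect':
  fixes a :: "'a::euclidean_space"
  assumes "f \<in> borel_measurable lebesgue"
  shows "(\<lambda>t. f (a - t)) \<in> borel_measurable lebesgue"
  using measurable_compose[OF measurable_lebesgue_reflect assms] .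

text \<open>A translation is two reflections in a row: \<open>- a - (0 - t) = t - a\<close>. The
  translation lemmas below rest on the same identity.\<close>

lemma measurable_lebesgue_translate:
  fixes a :: "'a::euclidean_space"
  assumes "f \<in> borel_measurable lebesgue"
  shows "(\<lambda>t. f (t - a)) \<in> borel_measurable lebesgue"
  using measurable_lebesgue_reflect'[OF measurable_lebesgue_reflect'[OF assms, of "- a"], of 0]
  by simp

lemma integrable_lebesgue_reflect:
  fixes a :: "'a::euclidean_space" and f :: "'a \<Rightarrow> 'b::{banach, second_countable_topology}"
  assumes "integrable lebesgue f"
  shows "integrable lebesgue (\<lambda>t. f (a - t))"
  by (rule integrable_distr[OF measurable_lebesgue_reflect])
    (simp add: distr_lebesgue_reflect assms)

lemma integral_lebesgue_reflect:
  fixes a :: "'a::euclidean_space" and f :: "'a \<Rightarrow> 'b::{banach, second_countable_topology}"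
  assumes "f \<in> borel_measurable lebesgue"
  shows "integral\<^sup>L lebesgue (\<lambda>t. f (a - t)) = integral\<^sup>L lebesgue f"
  using integral_distr[OF measurable_lebesgue_reflect assms, of a]
  by (simp add: distr_lebesgue_reflect)

lemma integrable_lebesgue_translate:
  fixes a :: "'a::euclidean_space" and f :: "'a \<Rightarrow> 'b::{banach, second_countable_topology}"
  assumes "integrable lebesgue f"
  shows "integrable lebesgue (\<lambda>t. f (t - a))"
  using integrable_lebesgue_reflect[OF integrable_lebesgue_reflect[OF assms, of "- a"], of 0]
  by simp

lemma integral_lebesgue_translate:
  fixes a :: "'a::euclidean_space" and f :: "'a \<Rightarrow> 'b::{banach, second_countable_topology}"
  assumes "f \<in> borel_measurable lebesgue"
  shows "integral\<^sup>L lebesgue (\<lambda>t. f (t - a)) = integral\<^sup>L lebesgue f"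
  using integral_lebesgue_reflect[OF measurable_lebesgue_reflect'[OF assms, of "- a"], of 0]
    integral_lebesgue_reflect[OF assms, of "- a"]
  by simp

lemma AE_lebesgue_reflect:
  fixes a :: "'a::euclidean_space"
  assumes "AE t in lebesgue. P t"
  shows "AE t in lebesgue. P (a - t)"
  by (rule AE_distrD[OF measurable_lebesgue_reflect, where P=P])
    (unfold distr_lebesgue_reflect, rule assms)

lemma AE_lebesgue_translate:
  fixes a :: "'a::euclidean_space"
  assumes "AE t in lebesgue. P t"
  shows "AE t in lebesgue. P (t - a)"
  using AE_lebesgue_reflect[OF AE_lebesgue_reflect[OF assms, of "- a"], of 0] by simp

section \<open>Periodicity against integrability\<close>

text \<open>Integrating over the half-spaces \<open>H s\<close> gives a function \<open>J\<close>
  with period \<open>l \<bullet> l\<close>. It tends to 0 in one direction and to the full integral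
  in the other, so the two limits agree.\<close>

lemma integrable_periodic_integral_eq_0:
  fixes h :: "'a::euclidean_space \<Rightarrow> real" and l :: 'a
  assumes h: "integrable lebesgue h" and l: "l \<noteq> 0"
    and per: "AE t in lebesgue. h t = h (t - l)"
  shows "integral\<^sup>L lebesgue h = 0"
proof -
  define H where "H s = {t. s < t \<bullet> l}" for s
  define J where "J s = (LINT t|lebesgue. indicator (H s) t * h t)" for s
  have ll: "l \<bullet> l > 0" using l by simp
  have [measurable]: "h \<in> borel_measurable lebesgue" using h by auto
  have "open (H s)" for s
    unfolding H_def by (intro open_Collect_less continuous_intros)
  then have [measurable]: "H s \<in> sets lebesgue" for s
    by auto
  have step: "J (s + l \<bullet> l) = J s" for s
  proof -
    \<comment> \<open>A point \<open>t\<close> lies in \<open>H (s + l \<bullet> l)\<close> exactly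
      when \<open>t - l\<close> lies in \<open>H s\<close>.\<close>
    have "J (s + l \<bullet> l) = (LINT t|lebesgue. indicator (H s) (t - l) * h (t - l))"
      unfolding J_def
    proof (rule integral_cong_AE)
      show "(\<lambda>t. indicator (H s) (t - l) * h (t - l)) \<in> borel_measurable lebesgue"
        by (rule measurable_lebesgue_translate[where f="\<lambda>t. indicator (H s) t * h t"]) measurable
      show "AE t in lebesgue. indicator (H (s + l \<bullet> l)) t * h t
          = indicator (H s) (t - l) * h (t - l)"
        using per by eventually_elim (auto simp: H_def indicator_def inner_diff_left)
    qed measurable
    also have "\<dots> = J s"
      unfolding J_def
      by (rule integral_lebesgue_translate[where f="\<lambda>t. indicator (H s) t * h t"]) measurable
    finally show ?thesis .
  qed
  have up: "J (real n * (l \<bullet> l)) = J 0" for n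
  proof (induction n)
    case (Suc n)
    then show ?case using step[of "real n * (l \<bullet> l)"] by (simp add: algebra_simps)
  qed simp
  have down: "J (- real n * (l \<bullet> l)) = J 0" for n
  proof (induction n)
    case (Suc n)
    then show ?case using step[of "- real (Suc n) * (l \<bullet> l)"] by (simp add: algebra_simps)
  qed simp
  have far: "\<forall>\<^sub>F n in sequentially. c < real n * (l \<bullet> l)" for c
  proof -
    have "filterlim (\<lambda>n. real n * (l \<bullet> l)) at_top sequentially"
      by (rule filterlim_at_top_mult_tendsto_pos[OF tendsto_const ll filterlim_real_sequentially])
    then show ?thesis by (simp add: filterlim_at_top_dense)
  qed
  \<comment> \<open>Each point eventually drops out of the receding half-spaces, while
    \<open>up\<close> makes the sequence constant.\<close>
  have "(\<lambda>n. J (real n * (l \<bullet> l))) \<longlonglongrightarrow> (LINT t::'a|lebesgue. 0)"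
    unfolding J_def
  proof (rule integral_dominated_convergence[where w="\<lambda>t. \<bar>h t\<bar>"])
    show "AE t in lebesgue. (\<lambda>n. indicator (H (real n * (l \<bullet> l))) t * h t) \<longlonglongrightarrow> 0"
    proof (rule AE_I2)
      fix t
      have "\<forall>\<^sub>F n in sequentially. indicator (H (real n * (l \<bullet> l))) t * h t = 0"
        using far[of "t \<bullet> l"] by eventually_elim (auto simp: H_def)
      then show "(\<lambda>n. indicator (H (real n * (l \<bullet> l))) t * h t) \<longlonglongrightarrow> 0"
        by (rule tendsto_eventually)
    qed
  qed (use h in \<open>auto simp: indicator_def\<close>)
  then have "J 0 = 0"
    unfolding up by (simp add: LIMSEQ_const_iff)
  \<comment> \<open>In the other direction the half-spaces exhaust the whole space.\<close>
  have "(\<lambda>n. J (- real n * (l \<bullet> l))) \<longlonglongrightarrow> integral\<^sup>L lebesgue h"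
    unfolding J_def
  proof (rule integral_dominated_convergence[where w="\<lambda>t. \<bar>h t\<bar>"])
    show "AE t in lebesgue. (\<lambda>n. indicator (H (- real n * (l \<bullet> l))) t * h t) \<longlonglongrightarrow> h t"
    proof (rule AE_I2)
      fix t
      have "\<forall>\<^sub>F n in sequentially. indicator (H (- real n * (l \<bullet> l))) t * h t = h t"
        using far[of "- (t \<bullet> l)"] by eventually_elim (auto simp: H_def)
      then show "(\<lambda>n. indicator (H (- real n * (l \<bullet> l))) t * h t) \<longlonglongrightarrow> h t"
        by (rule tendsto_eventually)
    qed
  qed (use h in \<open>auto simp: indicator_def\<close>)
  then have "J 0 = integral\<^sup>L lebesgue h"
    unfolding down by (simp add: LIMSEQ_const_iff)
  with \<open>J 0 = 0\<close> show ?thesis by simp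
qed

text \<open>Taking moduli turns phase equivalence into proportionality of \<open>p\<^sup>2\<close>
  and its translate. Both have the same nonzero integral, so the factors \<open>a\<close> and
  \<open>b\<close> coincide and \<open>p\<^sup>2\<close> is periodic.\<close>

lemma translate_combination_not_phase_equivalent:
  fixes p :: "real^'n \<Rightarrow> real"
  assumes p: "L2_real p" and nz: "\<not> (AE t in lebesgue. p t = 0)" and l: "l \<noteq> 0"
    and nu: "cmod \<nu> = 1"
  shows "\<not> (AE t in lebesgue. Complex (p t) (p (t - l)) = \<nu> * Complex (p t) (- p (t - l)))"
proof
  assume AE: "AE t in lebesgue. Complex (p t) (p (t - l)) = \<nu> * Complex (p t) (- p (t - l))"
  define a b where "a = (cmod (1 - \<nu>))\<^sup>2" and "b = (cmod (1 + \<nu>))\<^sup>2"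
  define I where "I = (LINT t|lebesgue. (p t)\<^sup>2)"
  have int: "integrable lebesgue (\<lambda>t. (p t)\<^sup>2)" using p by (simp add: L2_real_def)
  have int': "integrable lebesgue (\<lambda>t. (p (t - l))\<^sup>2)"
    using integrable_lebesgue_translate[OF int] .
  have I': "(LINT t|lebesgue. (p (t - l))\<^sup>2) = I"
    unfolding I_def using int by (intro integral_lebesgue_translate) auto
  have "I \<noteq> 0"
    using nz unfolding I_def by (subst integral_nonneg_eq_0_iff_AE[OF int]) auto
  have ab: "a + b = 4"
  proof -
    have "(Re \<nu>)\<^sup>2 + (Im \<nu>)\<^sup>2 = 1" using nu by (simp add: cmod_power2[symmetric])
    then show ?thesis
      unfolding a_def b_def cmod_power2 by (simp add: power2_eq_square algebra_simps)
  qed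
  have eq: "AE t in lebesgue. a * (p t)\<^sup>2 = b * (p (t - l))\<^sup>2"
    using AE
  proof eventually_elim
    case (elim t)
    then have "(1 - \<nu>) * of_real (p t) = - \<i> * (1 + \<nu>) * of_real (p (t - l))"
      by (simp add: complex_eq_iff algebra_simps)
    then have "cmod ((1 - \<nu>) * of_real (p t)) = cmod (- \<i> * (1 + \<nu>) * of_real (p (t - l)))"
      by simp
    then have "cmod (1 - \<nu>) * \<bar>p t\<bar> = cmod (1 + \<nu>) * \<bar>p (t - l)\<bar>"
      by (simp add: norm_mult)
    then have "(cmod (1 - \<nu>) * \<bar>p t\<bar>)\<^sup>2 = (cmod (1 + \<nu>) * \<bar>p (t - l)\<bar>)\<^sup>2"
      by simp
    then show ?case by (simp add: a_def b_def power_mult_distrib)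
  qed
  have "(LINT t|lebesgue. a * (p t)\<^sup>2) = (LINT t|lebesgue. b * (p (t - l))\<^sup>2)"
    by (rule integral_cong_AE) (use int int' eq in auto)
  then have "a * I = b * I"
    by (simp add: I_def[symmetric] I')
  then have "a = 2" "b = 2" using \<open>I \<noteq> 0\<close> ab by auto
  then have "AE t in lebesgue. (p t)\<^sup>2 = (p (t - l))\<^sup>2"
    using eq by simp
  then have "I = 0"
    unfolding I_def by (rule integrable_periodic_integral_eq_0[OF int l])
  with \<open>I \<noteq> 0\<close> show False by simp
qed

section \<open>Square-integrable functions and their transforms\<close>

lemma L2_real_reflect:
  fixes g :: "real^'n \<Rightarrow> real"
  assumes "L2_real g"
  shows "L2_real (\<lambda>t. g (a - t))"
  using assms unfolding L2_real_def
  by (auto intro: measurable_lebesgue_reflect' integrable_lebesgue_reflect[where f="\<lambda>t. (g t)\<^sup>2"])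

lemma L2_real_translate:
  fixes g :: "real^'n \<Rightarrow> real"
  assumes "L2_real g"
  shows "L2_real (\<lambda>t. g (t - a))"
  using assms unfolding L2_real_def
  by (auto intro: measurable_lebesgue_translate integrable_lebesgue_translate[where f="\<lambda>t. (g t)\<^sup>2"])

lemma L2_Complex:
  fixes p q :: "real^'n \<Rightarrow> real"
  assumes "L2_real p" "L2_real q"
  shows "L2 (\<lambda>t. Complex (p t) (q t))"
  using assms unfolding L2_def L2_real_def by (auto simp: cmod_power2 borel_measurable_complex_iff)

lemma borel_measurable_exp_inner:
  fixes w :: "real^'n"
  shows "(\<lambda>t. exp (- 2 * of_real pi * \<i> * of_real (w \<bullet> t)) :: complex) \<in> borel_measurable lebesgue"
proof -
  have "continuous_on UNIV (\<lambda>t. exp (- 2 * of_real pi * \<i> * of_real (w \<bullet> t)) :: complex)"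
    by (intro continuous_intros)
  then show ?thesis
    by (intro measurable_completion) (auto intro: borel_measurable_continuous_onI)
qed

lemma STFT_integrand_measurable:
  fixes p g :: "real^'n \<Rightarrow> real"
  assumes "L2_real p" "L2_real g"
  shows "(\<lambda>t. of_real (p t) * cnj (of_real (g (t - x)))
      * exp (- 2 * of_real pi * \<i> * of_real (w \<bullet> t))) \<in> borel_measurable lebesgue"
proof -
  have [measurable]: "p \<in> borel_measurable lebesgue" "(\<lambda>t. g (t - x)) \<in> borel_measurable lebesgue"
    using assms L2_real_translate[of g x] by (auto simp: L2_real_def)
  note borel_measurable_exp_inner[measurable]
  show ?thesis unfolding complex_cnj_complex_of_real by measurable
qed

text \<open>The exponential has modulus 1, and a product of two reals is bounded by the sum of their
  squares. Integrability is what lets the transform be split in \<open>STFT_Complex\<close>.\<close>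

lemma STFT_integrand_integrable:
  fixes p g :: "real^'n \<Rightarrow> real"
  assumes "L2_real p" "L2_real g"
  shows "integrable lebesgue (\<lambda>t. of_real (p t) * cnj (of_real (g (t - x)))
      * exp (- 2 * of_real pi * \<i> * of_real (w \<bullet> t)))"
proof (rule Bochner_Integration.integrable_bound)
  show "integrable lebesgue (\<lambda>t. (p t)\<^sup>2 + (g (t - x))\<^sup>2)"
    using assms L2_real_translate[of g x] by (auto simp: L2_real_def)
  have "\<bar>a * b\<bar> \<le> a\<^sup>2 + b\<^sup>2" for a b :: real
    using sum_squares_bound[of "\<bar>a\<bar>" "\<bar>b\<bar>"] abs_ge_zero[of "a * b"]
    unfolding abs_mult power2_abs mult.assoc by linarith
  then show "AE t in lebesgue. norm (of_real (p t) * cnj (of_real (g (t - x)))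
      * exp (- 2 * of_real pi * \<i> * of_real (w \<bullet> t))) \<le> norm ((p t)\<^sup>2 + (g (t - x))\<^sup>2)"
    by (intro AE_I2) (simp add: norm_mult abs_mult)
qed (rule STFT_integrand_measurable[OF assms])

lemma STFT_Complex:
  fixes p q g :: "real^'n \<Rightarrow> real"
  assumes "L2_real p" "L2_real q" "L2_real g"
  shows "STFT (\<lambda>t. of_real (g t)) (\<lambda>t. Complex (p t) (q t)) x w
    = STFT (\<lambda>t. of_real (g t)) (\<lambda>t. of_real (p t)) x w
      + \<i> * STFT (\<lambda>t. of_real (g t)) (\<lambda>t. of_real (q t)) x w"
proof -
  let ?F = "\<lambda>h t. of_real (h t) * cnj (of_real (g (t - x)))
      * exp (- 2 * of_real pi * \<i> * of_real (w \<bullet> t)) :: complex"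
  note int = STFT_integrand_integrable[OF _ assms(3), of _ x w]
  have "STFT (\<lambda>t. of_real (g t)) (\<lambda>t. Complex (p t) (q t)) x w
      = integral\<^sup>L lebesgue (\<lambda>t. ?F p t + \<i> * ?F q t)"
    unfolding STFT_def by (simp add: Complex_eq algebra_simps)
  also have "\<dots> = integral\<^sup>L lebesgue (?F p) + integral\<^sup>L lebesgue (\<lambda>t. \<i> * ?F q t)"
    by (rule Bochner_Integration.integral_add[OF int[OF assms(1)] integrable_mult_right[OF int[OF assms(2)]]])
  finally show ?thesis
    unfolding STFT_def integral_mult_right_zero .
qed

text \<open>For fixed \<open>x\<close> and \<open>w\<close> the equation confines the transforms,
  for all such \<open>m\<close>, to one real line through 0 in the complex plane.\<close>

lemma STFT_reflected_window:
  fixes g :: "real^'n \<Rightarrow> real"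
  assumes g: "L2_real g" and int: "w \<bullet> m \<in> \<int>"
  shows "STFT (\<lambda>t. of_real (g t)) (\<lambda>t. of_real (g (m - t))) x w
    = exp (- 2 * of_real pi * \<i> * of_real (w \<bullet> x))
      * cnj (STFT (\<lambda>t. of_real (g t)) (\<lambda>t. of_real (g (m - t))) x w)"
    (is "?S = ?e * cnj ?S")
proof -
  let ?F = "\<lambda>t. of_real (g (m - t)) * cnj (of_real (g (t - x)))
      * exp (- 2 * of_real pi * \<i> * of_real (w \<bullet> t))"
  have one: "exp (- 2 * of_real pi * \<i> * of_real (w \<bullet> m)) = 1"
  proof -
    obtain k where "w \<bullet> m = of_int k" using int by (auto elim: Ints_cases)
    then show ?thesis by (auto simp: exp_eq_1 intro!: exI[of _ "- k"])
  qed
  \<comment> \<open>The reflection swaps the two real window factors and conjugates the exponential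
    up to the phase of \<open>x + m\<close>, to which \<open>m\<close> contributes 1.\<close>
  have F: "?F (x + m - t) = ?e * cnj (?F t)" for t
  proof -
    have "exp (- 2 * of_real pi * \<i> * of_real (w \<bullet> (x + m - t)))
        = ?e * exp (- 2 * of_real pi * \<i> * of_real (w \<bullet> m)) * cnj (exp (- 2 * of_real pi * \<i> * of_real (w \<bullet> t)))"
      unfolding exp_cnj by (simp add: exp_add[symmetric] inner_simps algebra_simps)
    moreover have "m - (x + m - t) = t - x" "x + m - t - x = m - t" by auto
    ultimately show ?thesis unfolding one by simp
  qed
  have "?S = integral\<^sup>L lebesgue (\<lambda>t. ?F (x + m - t))"
    unfolding STFT_def
    by (rule integral_lebesgue_reflect[symmetric])
      (rule STFT_integrand_measurable[OF L2_real_reflect[OF g] g])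
  also have "\<dots> = ?e * cnj ?S"
    unfolding F STFT_def integral_mult_right_zero Bochner_Integration.integral_cnj ..
  finally show ?thesis .
qed

lemma STFT_zero_window:
  fixes g :: "real^'n \<Rightarrow> real"
  assumes "AE t in lebesgue. g t = 0"
  shows "STFT (\<lambda>t. of_real (g t)) f x w = 0"
  unfolding STFT_def
proof (rule integral_eq_zero_AE)
  have "AE t in lebesgue. g (t - x) = 0"
    by (rule AE_lebesgue_translate[OF assms])
  then show "AE t in lebesgue. f t * cnj (of_real (g (t - x)))
      * exp (- 2 * of_real pi * \<i> * of_real (w \<bullet> t)) = 0"
    by eventually_elim simp
qed

section \<open>The dual lattice and the counterexample\<close>

text \<open>A row of the inverse of \<open>B\<close> serves as \<open>l\<close>: its inner product
  with \<open>B *v k\<close> is a coordinate of \<open>k\<close>.\<close>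

lemma dual_lattice_vector:
  fixes B :: "real^'n^'n"
  assumes "invertible B"
  obtains l where "l \<noteq> 0" "\<And>w. w \<in> lattice_of B \<Longrightarrow> w \<bullet> l \<in> \<int>"
proof -
  obtain C where C: "C ** B = mat 1" using assms by (auto simp: invertible_def)
  \<comment> \<open>Here \<open>undefined\<close> merely names some index; any row would do.\<close>
  define e :: "real^'n" where "e = axis undefined 1"
  have inner: "(B *v k) \<bullet> (e v* C) = k $ undefined" for k
  proof -
    have "(B *v k) \<bullet> (e v* C) = e \<bullet> (C *v (B *v k))"
      by (metis dot_lmul_matrix inner_commute)
    also have "\<dots> = k $ undefined"
      by (simp add: matrix_vector_mul_assoc C e_def inner_axis')
    finally show ?thesis .
  qed
  show thesis
  proof (rule that[of "e v* C"])
    show "e v* C \<noteq> 0" using inner[of e] by (auto simp: e_def)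
    show "w \<bullet> (e v* C) \<in> \<int>" if "w \<in> lattice_of B" for w
      using that by (auto simp: lattice_of_def inner)
  qed
qed

lemma exists_nonzero_L2_real:
  obtains p :: "real^'n \<Rightarrow> real" where "L2_real p" "\<not> (AE t in lebesgue. p t = 0)"
proof
  let ?p = "indicator (cbox 0 One) :: real^'n \<Rightarrow> real"
  have sq: "(\<lambda>t. (?p t)\<^sup>2) = ?p" by (auto simp: indicator_def)
  show "L2_real ?p"
    unfolding L2_real_def sq
    by (auto simp: emeasure_lborel_cbox_eq intro!: borel_measurable_indicator)
  show "\<not> (AE t in lebesgue. ?p t = 0)"
  proof
    assume "AE t in lebesgue. ?p t = 0"
    then have "AE t in lebesgue. t \<notin> cbox 0 (One::real^'n)"
      by eventually_elim (auto simp: indicator_def)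
    then have "emeasure lebesgue (cbox 0 (One::real^'n)) = 0"
      by (subst (asm) AE_iff_measurable[OF _ refl]) auto
    then show False by simp
  qed
qed

theorem theorem1p4:
  fixes g :: "real^'n \<Rightarrow> real" and A B :: "real^'n^'n"
  assumes "L2_real g" and "invertible A" and "invertible B"
  shows "\<exists>f1 f2 :: real^'n \<Rightarrow> complex. L2 f1 \<and> L2 f2 \<and>
    (\<forall>x\<in>lattice_of A. \<forall>\<omega>\<in>lattice_of B.
        cmod (STFT (\<lambda>t. of_real (g t)) f1 x \<omega>) = cmod (STFT (\<lambda>t. of_real (g t)) f2 x \<omega>)) \<and>
    (\<forall>t. cmod (f1 t) = cmod (f2 t)) \<and>
    \<not> (\<exists>\<nu>::complex. cmod \<nu> = 1 \<and> (AE t in lebesgue. f1 t = \<nu> * f2 t))"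
proof -
  obtain l where l: "l \<noteq> 0" "\<And>w. w \<in> lattice_of B \<Longrightarrow> w \<bullet> l \<in> \<int>"
    using dual_lattice_vector[OF assms(3)] by blast
  \<comment> \<open>With \<open>p\<close> nonzero in both cases, only the equality of the transforms
    has to look at which case holds.\<close>
  obtain p :: "real^'n \<Rightarrow> real" where p: "L2_real p" "\<not> (AE t in lebesgue. p t = 0)"
    and pg: "(AE t in lebesgue. g t = 0) \<or> p = (\<lambda>t. g (- t))"
  proof (cases "AE t in lebesgue. g t = 0")
    case True
    then show thesis using exists_nonzero_L2_real that by metis
  next
    case False
    then have "\<not> (AE t in lebesgue. g (- t) = 0)"
      using AE_lebesgue_reflect[of "\<lambda>t. g (- t) = 0" 0] by auto
    then show thesis using that[of "\<lambda>t. g (- t)"] L2_real_reflect[OF assms(1), of 0] by simp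
  qed
  define f1 f2 where "f1 t = Complex (p t) (p (t - l))" and "f2 t = Complex (p t) (- p (t - l))" for t
  have pl: "L2_real (\<lambda>t. p (t - l))" "L2_real (\<lambda>t. - p (t - l))"
    using L2_real_translate[OF p(1), of l] by (auto simp: L2_real_def)
  have "cmod (STFT (\<lambda>t. of_real (g t)) f1 x w) = cmod (STFT (\<lambda>t. of_real (g t)) f2 x w)"
    if w: "w \<in> lattice_of B" for x w
    using pg
  proof
    assume "AE t in lebesgue. g t = 0"
    then show ?thesis by (simp add: STFT_zero_window)
  next
    assume pg: "p = (\<lambda>t. g (- t))"
    define e where "e = exp (- 2 * of_real pi * \<i> * of_real (w \<bullet> x))"
    define S where "S m = STFT (\<lambda>t. of_real (g t)) (\<lambda>t. of_real (g (m - t))) x w" for m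
    have S: "S 0 = e * cnj (S 0)" "S l = e * cnj (S l)"
      unfolding S_def e_def using l(2)[OF w]
      by (intro STFT_reflected_window[OF assms(1)]; simp)+
    have neg: "STFT (\<lambda>t. of_real (g t)) (\<lambda>t. of_real (- g (l - t))) x w = - S l"
      unfolding S_def STFT_def by simp
    have f1: "STFT (\<lambda>t. of_real (g t)) f1 x w = S 0 + \<i> * S l"
      using STFT_Complex[OF p(1) pl(1) assms(1), of x w] unfolding f1_def S_def by (simp add: pg)
    have f2: "STFT (\<lambda>t. of_real (g t)) f2 x w = S 0 - \<i> * S l"
      using STFT_Complex[OF p(1) pl(2) assms(1), of x w] neg unfolding f2_def S_def by (simp add: pg)
    \<comment> \<open>Conjugation flips the sign of \<open>\<i>\<close>, which exchanges the two
      transforms up to the common phase \<open>e\<close>.\<close>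
    have "S 0 + \<i> * S l = e * cnj (S 0 - \<i> * S l)"
      by (subst S(1), subst S(2)) (simp add: algebra_simps)
    moreover have "cmod e = 1" by (simp add: e_def)
    ultimately show ?thesis
      unfolding f1 f2 by (metis norm_mult complex_mod_cnj mult_1)
  qed
  moreover have "L2 f1" "L2 f2"
    unfolding f1_def f2_def by (intro L2_Complex p pl)+
  moreover have "cmod (f1 t) = cmod (f2 t)" for t
    by (simp add: f1_def f2_def cmod_def)
  moreover have "\<not> (AE t in lebesgue. f1 t = \<nu> * f2 t)" if "cmod \<nu> = 1" for \<nu>
    unfolding f1_def f2_def by (rule translate_combination_not_phase_equivalent[OF p l(1) that])
  ultimately show ?thesis by blast
qed

end
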